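(* Let $\mathscr D$ be the diagram of a composition $(c_1,\dots,c_k)$ of a positive integer $n$ with $k\ge 2$, and let $\mathscr D^k$ be the diagram obtained by deleting the last column $C_k$. Then: (i) Let $c\le|\mathscr D^k|$, where $|\mathscr D^k|=\max_{1\le i\le k-1}c_i$, and suppose $\mathscr S^c$ is a right extremal column staircase of depth $c$ in $\mathscr D^k$. Then the box $b(\mathscr S^c)$ is right extremal in $\mathscr D^k$. (ii) The remaining right extremal boxes in $\mathscr D^k$ are those belonging to the lower part $C_i^L$ of each right extremal column $C_i$ of $\mathscr D^k$, i.e. the boxes of $C_i$ in rows $R_j$ with $j>c$, where $c=c^i:=\max_{i<j<k}c_j$ (and $c=0$ if $i=k-1$), except possibly the box in the top row $R_{c+1}$ of $C_i^L$, which is omitted exactly when there is a right extremal column staircase $\mathscr S^{c}$ of depth $c$ in $\mathscr D^k$ (necessarily to the right of $C_i$).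
   Context: Diagram. The diagram of $(c_1,\dots,c_k)$ has columns $C_1,\dots,C_k$ (left to right), all starting in row $R_1$ (rows numbered $1,2,\dots$ from top to bottom); $C_i$ consists of $c_i$ boxes, in rows $R_1,\dots,R_{c_i}$, and its height is $c_i$. $\mathscr T$ is the tableau obtained by inserting $1,\dots,n$ into the boxes, down the columns and then from left to right over columns; $b(s)$ is the box labelled $s$ in $\mathscr T$. The left neighbour of a column is the nearest column of the same height to its left, if one exists. Column staircases (in a diagram). A column staircase $\mathscr S_u^c$ (of height $u$ and depth $c$, $1\le u\le c$) is a maximal set of columns $C'_u,C'_{u+1},\dots,C'_c$, going from left to right, such that $C'_j$ has height $j$ and has a left neighbour for each $j\in[u,c]$, and there are no columns of height $\ge j$ strictly between $C'_j$ and $C'_{j+1}$ for $u\le j<c$. The box $b(\mathscr S_u^c)$ is the nearest box of the diagram to the left of $C'_u\cap R_u$ in row $R_u$. When $u$ is unspecified write $\mathscr S^c$. The staircase is right extremal if there are no columns of height $\ge c$ to the right of $C'_c$. A column $C_i$, $i\in[1,k-1]$, is right extremal in $\mathscr D^k$ if $c_i>c^i$, with $c^i$ as in the claim. A box $b$ of a diagram is right extremal (relative to the set of lines $\ell$ of that diagram) if there is no line labelled $1$ whose left end point is $b$. The set of lines $\ell(\mathscr E)$ of a diagram $\mathscr E$ with columns $C_1,\dots,C_q$ of heights $c_1,\dots,c_q$ is defined as follows. The tableau $\mathscr T(\infty)$. Let $\preceq$ be the total order on the labels in which labels of $\mathscr T$ increase strictly down each column and then from right to left over columns (all labels in $C_q$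 from top to bottom, then those of $C_{q-1}$, etc.). Allow arbitrarily many rows in each of the $q$ columns; "height" always refers to $\mathscr E$. Start with $\mathscr T$ and treat the labels one after another in increasing $\preceq$-order. For the current label $l$, repeat: let $R_p\cap C_j$ be the rightmost position currently containing $l$; if $j=q$ stop. If $c_{j+1}<p$: when $R_p\cap C_{j+1}$ is empty put $l$ there, otherwise stop. If $c_{j+1}=p$: when $C_{j+1}$ has a left neighbour and $R_{p+1}\cap C_{j+1}$ is empty put $l$ in $R_{p+1}\cap C_{j+1}$, otherwise stop. If $c_{j+1}>p$ stop. The lines. A line joins a box (left end point) to a box in a column strictly further right (right end point) and carries a label $1$ or $\ast$. For each $m\in\{2,\dots,q\}$ put $h=c_m$, and let $r_i$ be the entry of $\mathscr T(\infty)$ in $R_i\cap C_{m-1}$ ($r_i=0$ if empty). The lines with right end point in $C_m$ are exactly: (1) for $1\le i\le h-1$ with $r_i\ne0$, a line labelled $1$ from $b(r_i)$ to $C_m\cap R_i$; (2) if some column to the left of $C_m$ has height $h$: a line labelled $\ast$ from $b(r_h)$ to $C_m\cap R_h$ and, if $r_{h+1}\neq0$, a line labelled $1$ from $b(r_{h+1})$ to $C_m\cap R_h$; (3) if no column to the left of $C_m$ has height $h$ and $r_h\ne0$: a line labelled $1$ from $b(r_h)$ to $C_m\cap R_h$. *)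

theory Defs
  imports Main
begin

text \<open>
  A diagram is given by the list of its column heights.  Rows and columns are numbered from 1, and
  a pair \<open>(p, j)\<close> stands for the position \<open>R\<^sub>p \<inter> C\<^sub>j\<close>.
\<close>

definition composition :: "nat \<Rightarrow> nat list \<Rightarrow> bool" where
  "composition n c \<longleftrightarrow> (\<forall>x\<in>set c. 0 < x) \<and> sum_list c = n"

definition col_height :: "nat list \<Rightarrow> nat \<Rightarrow> nat" where
  "col_height c j = c ! (j - 1)"

definition boxes :: "nat list \<Rightarrow> (nat \<times> nat) set" where
  "boxes c = {(p, j). j \<in> {1..length c} \<and> p \<in> {1..col_height c j}}"

definition label :: "nat list \<Rightarrow> nat \<times> nat \<Rightarrow> nat" where
  "label c = (\<lambda>(p, j). sum_list (take (j - 1) c) + p)"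

definition box_of :: "nat list \<Rightarrow> nat \<Rightarrow> nat \<times> nat" where
  "box_of c s = (THE b. b \<in> boxes c \<and> label c b = s)"

definition has_left_neighbour :: "nat list \<Rightarrow> nat \<Rightarrow> bool" where
  "has_left_neighbour c j \<longleftrightarrow> (\<exists>i\<in>{1..<j}. col_height c i = col_height c j)"


subsection \<open>The tableau \<open>\<T>(\<infinity>)\<close>\<close>

text \<open>Tableaux are total functions on positions; the value 0 (which is not a label) means that the
  position is empty.\<close>

type_synonym tableau = "nat \<times> nat \<Rightarrow> nat"

definition initial_tableau :: "nat list \<Rightarrow> tableau" where
  "initial_tableau c = (\<lambda>b. if b \<in> boxes c then label c b else 0)"

text \<open>In \<open>spread c l p j T\<close>, the pair \<open>(p, j)\<close> is the rightmost position of \<open>T\<close> containing the current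
  label \<open>l\<close>.  Every insertion of \<open>l\<close> is made in column \<open>j + 1\<close>, so the position just filled is the
  next rightmost one.\<close>

function spread :: "nat list \<Rightarrow> nat \<Rightarrow> nat \<Rightarrow> nat \<Rightarrow> tableau \<Rightarrow> tableau" where
  "spread c l p j T =
    (if j \<ge> length c then T
     else if col_height c (j + 1) < p then
       (if T (p, j + 1) = 0 then spread c l p (j + 1) (T((p, j + 1) := l)) else T)
     else if col_height c (j + 1) = p then
       (if has_left_neighbour c (j + 1) \<and> T (p + 1, j + 1) = 0
        then spread c l (p + 1) (j + 1) (T((p + 1, j + 1) := l)) else T)
     else T)"
  by pat_completeness auto
termination
  by (relation "measure (\<lambda>(c, l, p, j, T). length c - j)") auto

declare spread.simps [simp del]

text \<open>The boxes in increasing \<open>\<preceq>\<close>-order of their labels: columns from right to left, each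
  column from top to bottom.\<close>

definition boxes_in_order :: "nat list \<Rightarrow> (nat \<times> nat) list" where
  "boxes_in_order c =
    concat (map (\<lambda>j. map (\<lambda>p. (p, j)) [1..<col_height c j + 1]) (rev [1..<length c + 1]))"

definition tableau_infinity :: "nat list \<Rightarrow> tableau" where
  "tableau_infinity c =
    fold (\<lambda>(p, j). spread c (label c (p, j)) p j) (boxes_in_order c) (initial_tableau c)"


subsection \<open>Lines\<close>

datatype line_label = One | Star

text \<open>A line is a triple (left end point, right end point, label).\<close>

inductive_set lines :: "nat list \<Rightarrow> ((nat \<times> nat) \<times> (nat \<times> nat) \<times> line_label) set"
  for c :: "nat list"
where
  above: "m \<in> {2..length c} \<Longrightarrow> h = col_height c m \<Longrightarrow> 1 \<le> i \<Longrightarrow> i < h \<Longrightarrow>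
    r = tableau_infinity c (i, m - 1) \<Longrightarrow> r \<noteq> 0 \<Longrightarrow>
    (box_of c r, (i, m), One) \<in> lines c"
| neighbour_star: "m \<in> {2..length c} \<Longrightarrow> h = col_height c m \<Longrightarrow> has_left_neighbour c m \<Longrightarrow>
    r = tableau_infinity c (h, m - 1) \<Longrightarrow>
    (box_of c r, (h, m), Star) \<in> lines c"
| neighbour_one: "m \<in> {2..length c} \<Longrightarrow> h = col_height c m \<Longrightarrow> has_left_neighbour c m \<Longrightarrow>
    r = tableau_infinity c (h + 1, m - 1) \<Longrightarrow> r \<noteq> 0 \<Longrightarrow>
    (box_of c r, (h, m), One) \<in> lines c"
| no_neighbour: "m \<in> {2..length c} \<Longrightarrow> h = col_height c m \<Longrightarrow> \<not> has_left_neighbour c m \<Longrightarrow>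
    r = tableau_infinity c (h, m - 1) \<Longrightarrow> r \<noteq> 0 \<Longrightarrow>
    (box_of c r, (h, m), One) \<in> lines c"

definition right_extremal_box :: "nat list \<Rightarrow> nat \<times> nat \<Rightarrow> bool" where
  "right_extremal_box c b \<longleftrightarrow> b \<in> boxes c \<and> \<not> (\<exists>b'. (b, b', One) \<in> lines c)"


subsection \<open>Column staircases\<close>

text \<open>A staircase is represented by the set \<open>S\<close> of its column numbers; \<open>f j\<close> is the number of
  \<open>C'\<^sub>j\<close>.  Since columns are listed from left to right, \<open>C'\<^sub>u\<close> and the last column \<open>C'\<^sub>d\<close>
  (\<open>d\<close> being the depth) are recovered as \<open>Min S\<close> and \<open>Max S\<close>.\<close>

definition staircase_columns :: "nat list \<Rightarrow> nat \<Rightarrow> nat \<Rightarrow> nat set \<Rightarrow> bool" where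
  "staircase_columns c u d S \<longleftrightarrow> 1 \<le> u \<and> u \<le> d \<and>
    (\<exists>f :: nat \<Rightarrow> nat. S = f ` {u..d} \<and> strict_mono_on {u..d} f \<and>
      (\<forall>j\<in>{u..d}. f j \<in> {1..length c} \<and> col_height c (f j) = j \<and> has_left_neighbour c (f j)) \<and>
      (\<forall>j\<in>{u..<d}. \<forall>i. f j < i \<and> i < f (j + 1) \<longrightarrow> col_height c i < j))"

definition column_staircase :: "nat list \<Rightarrow> nat \<Rightarrow> nat \<Rightarrow> nat set \<Rightarrow> bool" where
  "column_staircase c u d S \<longleftrightarrow> staircase_columns c u d S \<and>
    (\<forall>u' d' S'. staircase_columns c u' d' S' \<and> S \<subseteq> S' \<longrightarrow> S' = S)"

definition staircase_box :: "nat list \<Rightarrow> nat \<Rightarrow> nat set \<Rightarrow> nat \<times> nat" where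
  "staircase_box c u S = (u, Max {i. (u, i) \<in> boxes c \<and> i < Min S})"

definition right_extremal_staircase :: "nat list \<Rightarrow> nat \<Rightarrow> nat \<Rightarrow> nat set \<Rightarrow> bool" where
  "right_extremal_staircase c u d S \<longleftrightarrow> column_staircase c u d S \<and>
    (\<forall>i\<in>{1..length c}. Max S < i \<longrightarrow> col_height c i < d)"


subsection \<open>Right extremal columns\<close>

definition max_height_right :: "nat list \<Rightarrow> nat \<Rightarrow> nat" where
  "max_height_right c i = Max (insert 0 (col_height c ` {i<..length c}))"

definition right_extremal_column :: "nat list \<Rightarrow> nat \<Rightarrow> bool" where
  "right_extremal_column c i \<longleftrightarrow> i \<in> {1..length c} \<and> col_height c i > max_height_right c i"

definition lower_part :: "nat list \<Rightarrow> nat \<Rightarrow> (nat \<times> nat) set" where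
  "lower_part c i = {(p, j) \<in> boxes c. j = i \<and> p > max_height_right c i}"

end

theory Submission
  imports Defs
begin

text \<open>
  Column \<open>C\<^sub>m\<close> of \<open>\<T>(\<infinity>)\<close> is determined by column \<open>C\<^sub>m\<^sub>-\<^sub>1\<close>: rows up to the height \<open>h\<close> of \<open>C\<^sub>m\<close> hold its own
  labels, lower rows are copied from \<open>C\<^sub>m\<^sub>-\<^sub>1\<close>, except that when \<open>C\<^sub>m\<close> has a left neighbour row \<open>h + 1\<close>
  receives the entry in row \<open>h\<close>.  That entry always wins against the one in row \<open>h + 1\<close>, because the
  labels in each column of \<open>\<T>(\<infinity>)\<close> are \<open>\<preceq>\<close>-increasing.  A label is dropped between \<open>C\<^sub>m\<^sub>-\<^sub>1\<close> and \<open>C\<^sub>m\<close>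
  exactly when its box starts a line labelled 1 ending in \<open>C\<^sub>m\<close>, so the right extremal boxes are those
  whose labels reach the last column.  Tracing row \<open>d + 1\<close> of the last column back to the left, one
  either stays in that row until meeting a column of height greater than \<open>d\<close>, which is then right
  extremal, or descends a right extremal staircase of depth \<open>d\<close> and ends in its box.
\<close>

section \<open>Boxes, their labels and the order of treatment\<close>

lemma sum_list_take_mono:
  fixes c :: "nat list"
  assumes "j \<le> k"
  shows "sum_list (take j c) \<le> sum_list (take k c)"
proof -
  have "take k c = take j c @ take (k - j) (drop j c)"
    using assms by (metis le_add_diff_inverse take_add)
  then show ?thesis by simp
qed

lemma label_le_sum_list_take:
  assumes "(p, j) \<in> boxes c"
  shows "label c (p, j) \<le> sum_list (take j c)"
proof -
  obtain i where i: "j = Suc i" "i < length c" "p \<le> c ! i"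
    using assms by (cases j) (auto simp: boxes_def col_height_def)
  then show ?thesis by (simp add: label_def take_Suc_conv_app_nth)
qed

lemma label_less:
  assumes "(p, j) \<in> boxes c" "(p', j') \<in> boxes c" "j < j'"
  shows "label c (p, j) < label c (p', j')"
proof -
  have "sum_list (take j c) \<le> sum_list (take (j' - 1) c)"
    using assms by (intro sum_list_take_mono) auto
  then show ?thesis
    using label_le_sum_list_take[OF assms(1)] assms(2) by (auto simp: label_def boxes_def)
qed

lemma inj_on_label: "inj_on (label c) (boxes c)"
proof (rule inj_onI)
  fix b b' assume *: "b \<in> boxes c" "b' \<in> boxes c" "label c b = label c b'"
  obtain p j p' j' where b: "b = (p, j)" "b' = (p', j')" by (metis surj_pair)
  have "j = j'"
    using * b label_less[of p j c p' j'] label_less[of p' j' c p j] by (metis nat_neq_iff)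
  then show "b = b'" using * b by (simp add: label_def)
qed

lemma box_of_label: "b \<in> boxes c \<Longrightarrow> box_of c (label c b) = b"
  unfolding box_of_def using inj_on_label[of c] by (auto intro!: the_equality dest: inj_onD)

lemma label_pos: "b \<in> boxes c \<Longrightarrow> 0 < label c b"
  by (auto simp: boxes_def label_def)

text \<open>The order \<preceq> of the labels, transported to boxes so that no arithmetic on labels
  is needed.\<close>

definition prec :: "nat \<times> nat \<Rightarrow> nat \<times> nat \<Rightarrow> bool" where
  "prec b b' \<longleftrightarrow> snd b' < snd b \<or> snd b = snd b' \<and> fst b < fst b'"

lemma prec_irrefl: "\<not> prec b b"
  by (simp add: prec_def)

lemma prec_asym: "prec b b' \<Longrightarrow> \<not> prec b' b"
  by (auto simp: prec_def)

lemma set_boxes_in_order: "set (boxes_in_order c) = boxes c"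
  by (force simp: boxes_in_order_def boxes_def)

text \<open>An arbitrary decreasing list of columns replaces the reversed range, so that the
  induction can split off one column.\<close>

lemma sorted_wrt_prec_columns:
  assumes "sorted_wrt (>) js"
  shows "sorted_wrt prec (concat (map (\<lambda>j. map (\<lambda>p. (p, j)) [1..<h j + 1]) js))"
  using assms
proof (induction js)
  case (Cons j js)
  have "sorted_wrt prec (map (\<lambda>p. (p, j)) [1..<h j + 1])"
    by (auto simp: sorted_wrt_map prec_def simp del: upt_Suc intro: sorted_wrt_mono_rel[OF _ sorted_wrt_upt])
  moreover have "prec b b'" if "b \<in> set (map (\<lambda>p. (p, j)) [1..<h j + 1])"
      "b' \<in> set (concat (map (\<lambda>j. map (\<lambda>p. (p, j)) [1..<h j + 1]) js))" for b b'
    using that Cons.prems by (auto simp: prec_def)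
  ultimately show ?case
    using Cons by (simp add: sorted_wrt_append del: upt_Suc)
qed simp

lemma sorted_wrt_prec_boxes_in_order: "sorted_wrt prec (boxes_in_order c)"
  unfolding boxes_in_order_def
  by (rule sorted_wrt_prec_columns) (simp add: sorted_wrt_rev del: upt_Suc)

section \<open>A recursive description of the columns of the final tableau\<close>

text \<open>\<open>entry c m p\<close> is the box whose label ends up in \<open>R\<^sub>p \<inter> C\<^sub>m\<close> of \<open>\<T>(\<infinity>)\<close>.\<close>

fun entry :: "nat list \<Rightarrow> nat \<Rightarrow> nat \<Rightarrow> (nat \<times> nat) option" where
  "entry c 0 p = None"
| "entry c (Suc m) p =
    (if p = 0 then None
     else if p \<le> col_height c (Suc m) then Some (p, Suc m)
     else if p = Suc (col_height c (Suc m)) \<and> has_left_neighbour c (Suc m)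
       then entry c m (col_height c (Suc m))
     else entry c m p)"

lemma entry_own: "0 < p \<Longrightarrow> 0 < m \<Longrightarrow> p \<le> col_height c m \<Longrightarrow> entry c m p = Some (p, m)"
  by (cases m) auto

lemma entry_row_zero [simp]: "entry c m 0 = None"
  by (cases m) auto

lemma entry_column_le: "entry c m p = Some (r, j) \<Longrightarrow> 0 < j \<and> j \<le> m"
  by (induction m arbitrary: p) (fastforce split: if_splits)+

lemma entry_own_column:
  assumes "entry c m p = Some (r, m)"
  shows "r = p" and "p \<le> col_height c m"
  using assms entry_column_le[of c "m - 1" _ r m] by (cases m; fastforce split: if_splits)+

lemma entry_in_boxes:
  assumes "entry c m p = Some b" "m \<le> length c"
  shows "b \<in> boxes c"
  using assms
  by (induction m arbitrary: p) (auto simp: boxes_def split: if_splits)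

text \<open>Induction on the column: its own boxes come first, being the rightmost, and inherited
  entries keep their vertical order, since the only change of row moves row \<open>h\<close> to row
  \<open>h + 1\<close>, where it displaces an entry from below.\<close>

lemma entry_prec:
  assumes "entry c m p = Some b" "entry c m p' = Some b'" "p < p'"
  shows "prec b b'"
  using assms
proof (induction m arbitrary: p p')
  case (Suc m)
  let ?h = "col_height c (Suc m)"
  consider "p' \<le> ?h" | "p \<le> ?h" "?h < p'" | "?h < p" by linarith
  then show ?case
  proof cases
    case 1
    with Suc.prems show ?thesis by (auto simp: prec_def split: if_splits)
  next
    case 2
    then obtain r where "entry c m r = Some b'" using Suc.prems by (auto split: if_splits)
    then have "snd b' \<le> m" using entry_column_le by (metis prod.collapse)
    moreover have "snd b = Suc m" using Suc.prems 2 by (auto split: if_splits)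
    ultimately show ?thesis by (simp add: prec_def)
  next
    case 3
    with Suc.prems have "entry c m p' = Some b'" by (auto split: if_splits)
    moreover have "\<exists>r\<le>p. entry c m r = Some b"
      using Suc.prems(1) 3 by (cases "p = Suc ?h \<and> has_left_neighbour c (Suc m)")
        (auto intro: exI[of _ ?h] split: if_splits)
    ultimately show ?thesis using Suc.IH Suc.prems(3) by (metis le_less_trans)
  qed
qed simp

lemma entry_inj:
  assumes "entry c m p = Some b" "entry c m p' = Some b"
  shows "p = p'"
  using entry_prec assms prec_irrefl by (metis nat_neq_iff)

text \<open>An occupied row stays occupied further right: the shifted row \<open>h + 1\<close> reads
  row \<open>h\<close>, which is a genuine row because heights are positive.\<close>

lemma entry_nonempty:
  assumes "\<forall>x\<in>set c. 0 < x" "1 \<le> i" "i \<le> m" "m \<le> length c" "0 < p" "p \<le> col_height c i"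
  shows "entry c m p \<noteq> None"
  using assms(3-6)
proof (induction m arbitrary: p)
  case (Suc m)
  have "0 < col_height c (Suc m)" using assms(1) Suc.prems by (simp add: col_height_def)
  with Suc show ?case by (cases "i = Suc m") auto
qed (use assms in simp)

text \<open>The left neighbour keeps row \<open>h\<close> occupied from its own column on, so the
  entry to be shifted always exists and can block its competitor in row
  \<open>h + 1\<close>.\<close>

lemma entry_left_neighbour:
  assumes "\<forall>x\<in>set c. 0 < x" "has_left_neighbour c (Suc m)" "m < length c"
  obtains b where "entry c m (col_height c (Suc m)) = Some b"
proof -
  obtain i where "1 \<le> i" "i \<le> m" "col_height c i = col_height c (Suc m)"
    using assms(2) by (auto simp: has_left_neighbour_def)
  moreover have "0 < col_height c (Suc m)" using assms by (simp add: col_height_def)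
  ultimately show ?thesis using entry_nonempty[of c i m "col_height c (Suc m)"] assms that by auto
qed

text \<open>Apart from its own boxes a column draws only on the preceding one, so a lost label
  cannot return.\<close>

lemma entry_vanished:
  assumes "\<And>p. entry c m p \<noteq> Some b" "snd b \<le> m" "m \<le> m'"
  shows "entry c m' p \<noteq> Some b"
  using assms(3)
proof (induction m' arbitrary: p rule: dec_induct)
  case (step m')
  then show ?case using assms(2) by auto
qed (use assms in simp)

text \<open>Let \<open>h\<close> be the height of the next column. Its own boxes hide the labels
  above row \<open>h\<close>; row \<open>h\<close> survives only by the shift, at the expense of row
  \<open>h + 1\<close>. The three alternatives are those of \<open>above\<close>,
  \<open>neighbour_one\<close> and \<open>no_neighbour\<close> in \<open>lines\<close>.\<close>

lemma entry_continues_iff: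
  assumes b: "entry c m p = Some b"
  shows "(\<exists>r. entry c (Suc m) r = Some b) \<longleftrightarrow>
    \<not> (p < col_height c (Suc m)
      \<or> has_left_neighbour c (Suc m) \<and> p = Suc (col_height c (Suc m))
      \<or> \<not> has_left_neighbour c (Suc m) \<and> p = col_height c (Suc m))"
    (is "?L \<longleftrightarrow> \<not> ?stop")
proof
  assume ?L
  then obtain r where r: "entry c (Suc m) r = Some b" ..
  have "snd b \<le> m" using entry_column_le b by (metis prod.collapse)
  with r have *: "r > col_height c (Suc m)" by (auto split: if_splits)
  show "\<not> ?stop"
  proof (cases "r = Suc (col_height c (Suc m)) \<and> has_left_neighbour c (Suc m)")
    case True
    then have "entry c m (col_height c (Suc m)) = Some b" using r * by simp
    then show ?thesis using True entry_inj[OF b] by auto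
  next
    case False
    then have "entry c m r = Some b" using r * by (auto split: if_splits)
    then have "p = r" using entry_inj[OF b] by blast
    then show ?thesis using False * by auto
  qed
next
  assume *: "\<not> ?stop"
  have "p \<noteq> 0" using b by (metis entry_row_zero option.distinct(1))
  show ?L
  proof (cases "p = col_height c (Suc m)")
    case True
    then have "entry c (Suc m) (Suc p) = Some b" using * b by simp
    then show ?thesis ..
  next
    case False
    then have "entry c (Suc m) p = Some b" using * b \<open>p \<noteq> 0\<close> by auto
    then show ?thesis ..
  qed
qed


section \<open>The insertion procedure produces the recursive description\<close>

text \<open>In an intermediate stage of the construction of \<open>\<T>(\<infinity>)\<close>, column \<open>m\<close> shows only the final entries
  \<open>b\<close> with \<open>Q m b\<close>.\<close>

definition filled :: "nat list \<Rightarrow> (nat \<Rightarrow> nat \<times> nat \<Rightarrow> bool) \<Rightarrow> tableau \<Rightarrow> bool" where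
  "filled c Q T \<longleftrightarrow> (\<forall>m\<in>{1..length c}. \<forall>r.
    T (r, m) = (case entry c m r of None \<Rightarrow> 0 | Some b \<Rightarrow> if Q m b then label c b else 0))"

lemma filled_cong:
  assumes "filled c Q T"
    and "\<And>m r b. 1 \<le> m \<Longrightarrow> m \<le> length c \<Longrightarrow> entry c m r = Some b \<Longrightarrow> Q m b = Q' m b"
  shows "filled c Q' T"
  unfolding filled_def
proof (intro ballI allI)
  fix m r assume "m \<in> {1..length c}"
  then show "T (r, m) = (case entry c m r of None \<Rightarrow> 0 | Some b \<Rightarrow> if Q' m b then label c b else 0)"
    using assms(1) assms(2)[of m r] unfolding filled_def by (cases "entry c m r") auto
qed

text \<open>The visibility condition reads: a box shows in its own column, everywhere once it
  belongs to the treated set \<open>P\<close>, and for the current box \<open>b\<close> up to the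
  column \<open>j\<close> reached so far.\<close>

lemma filled_update:
  assumes T: "filled c (\<lambda>m b'. snd b' = m \<or> b' \<in> P \<or> b' = b \<and> m \<le> j) T"
    and r: "entry c (Suc j) r = Some b"
  shows "filled c (\<lambda>m b'. snd b' = m \<or> b' \<in> P \<or> b' = b \<and> m \<le> Suc j) (T((r, Suc j) := label c b))"
  unfolding filled_def
proof (intro ballI allI)
  fix m s assume m: "m \<in> {1..length c}"
  show "(T((r, Suc j) := label c b)) (s, m) = (case entry c m s of None \<Rightarrow> 0
    | Some b' \<Rightarrow> if snd b' = m \<or> b' \<in> P \<or> b' = b \<and> m \<le> Suc j then label c b' else 0)"
  proof (cases "(s, m) = (r, Suc j)")
    case True
    then show ?thesis using r by (simp del: entry.simps)
  next
    case False
    \<comment> \<open>In column \<open>Suc j\<close> the box \<open>b\<close> occupies row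
      \<open>r\<close> only, so raising the bound affects no other position.\<close>
    then have "m \<le> Suc j \<longleftrightarrow> m \<le> j" if "entry c m s = Some b"
      using that entry_inj[OF r, of s] by (auto simp: le_Suc_eq simp del: entry.simps)
    then show ?thesis
      using T m False unfolding filled_def by (cases "entry c m s") auto
  qed
qed

text \<open>Induction on the number of columns right of \<open>j\<close>. Since \<open>P\<close>
  contains all predecessors of \<open>b\<close>, the conflict over row \<open>h + 1\<close> is
  decided correctly: the entry coming from row \<open>h\<close> precedes \<open>b\<close>, is
  already visible and blocks it.\<close>

lemma filled_spread:
  assumes pos: "\<forall>x\<in>set c. 0 < x"
    and "filled c (\<lambda>m b'. snd b' = m \<or> b' \<in> P \<or> b' = b \<and> m \<le> j) T"
    and "entry c j p = Some b" "1 \<le> j" "j \<le> length c"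
    and P: "\<And>b'. b' \<in> boxes c \<Longrightarrow> prec b' b \<Longrightarrow> b' \<in> P" "b \<notin> P"
  shows "filled c (\<lambda>m b'. snd b' = m \<or> b' \<in> insert b P) (spread c (label c b) p j T)"
  using assms(2-5)
proof (induction "length c - j" arbitrary: p j T)
  case 0
  \<comment> \<open>In the last column the bound \<open>m \<le> j\<close> excludes nothing.\<close>
  then have "filled c (\<lambda>m b'. snd b' = m \<or> b' \<in> insert b P) T"
    by (intro filled_cong[OF 0(2)]) auto
  with 0 show ?case by (simp add: spread.simps)
next
  case (Suc d)
  let ?h = "col_height c (Suc j)" and ?N = "has_left_neighbour c (Suc j)"
  have jq: "Suc j \<le> length c" and le: "snd b \<le> j"
    using Suc.hyps Suc.prems entry_column_le[of c j p] by (auto simp: prod_eq_iff)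
  have T: "T (r, Suc j) =
      (case entry c (Suc j) r of None \<Rightarrow> 0
       | Some b' \<Rightarrow> if snd b' = Suc j \<or> b' \<in> P then label c b' else 0)" for r
    using Suc.prems(1) jq unfolding filled_def by (auto split: option.splits)
  have "p \<noteq> 0" using Suc.prems(2) by (metis entry_row_zero option.distinct(1))
  \<comment> \<open>If \<open>b\<close> is lost after column \<open>j\<close>, it is an entry of no
    later column, so the bound \<open>m \<le> j\<close> may be dropped.\<close>
  have stop: ?case
    if s: "spread c (label c b) p j T = T"
      and "p < ?h \<or> ?N \<and> p = Suc ?h \<or> \<not> ?N \<and> p = ?h"
  proof -
    have "\<And>r. entry c (Suc j) r \<noteq> Some b"
      using entry_continues_iff[OF Suc.prems(2)] that by blast
    then have "entry c m r \<noteq> Some b" if "j < m" for m r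
      using entry_vanished[of c "Suc j" b m] le that by auto
    then have "filled c (\<lambda>m b'. snd b' = m \<or> b' \<in> insert b P) T"
      by (intro filled_cong[OF Suc.prems(1)]) (metis insert_iff not_less)
    then show ?thesis using s by simp
  qed
  have continue: ?case
    if s: "spread c (label c b) p j T = spread c (label c b) r (Suc j) (T((r, Suc j) := label c b))"
      and r: "entry c (Suc j) r = Some b" for r
    unfolding s using Suc.hyps jq by (intro Suc.hyps(1) filled_update Suc.prems(1) r) auto
  \<comment> \<open>The target of \<open>b\<close> is still free: \<open>b\<close> is not a box of
    column \<open>Suc j\<close>, is not yet treated, and no other box has this position as its final
    one.\<close>
  have empty: "T (r, Suc j) = 0" if "entry c (Suc j) r = Some b" for r
    using T that le P(2) by auto
  consider "p < ?h" | "\<not> ?N" "p = ?h" | "?N" "p = ?h" | "?N" "p = Suc ?h"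
    | "?h < p" "\<not> (?N \<and> p = Suc ?h)" by linarith
  then show ?case
  proof cases
    case 1
    then show ?thesis using stop jq by (simp add: spread.simps)
  next
    case 2
    then show ?thesis using stop jq by (simp add: spread.simps)
  next
    case 3
    then have e: "entry c (Suc j) (Suc p) = Some b" using Suc.prems(2) by simp
    have "spread c (label c b) p j T
        = spread c (label c b) (Suc p) (Suc j) (T((Suc p, Suc j) := label c b))"
      using 3 jq empty[OF e] by (subst spread.simps) simp
    then show ?thesis using continue e by blast
  next
    case 4
    obtain b' where b': "entry c j ?h = Some b'"
      using entry_left_neighbour[OF pos 4(1)] jq by auto
    have "prec b' b" using entry_prec[OF b' Suc.prems(2)] 4 by simp
    moreover have "b' \<in> boxes c" using entry_in_boxes[OF b'] jq by simp
    ultimately have "T (p, Suc j) \<noteq> 0"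
      using T[of p] 4 b' P(1) label_pos by simp
    then show ?thesis using 4 stop jq by (simp add: spread.simps)
  next
    case 5
    then have e: "entry c (Suc j) p = Some b" using Suc.prems(2) \<open>p \<noteq> 0\<close> by auto
    have "spread c (label c b) p j T
        = spread c (label c b) p (Suc j) (T((p, Suc j) := label c b))"
      using 5 jq empty[OF e] by (subst spread.simps) simp
    then show ?thesis using continue e by blast
  qed
qed

lemma filled_initial_tableau:
  "filled c (\<lambda>m b. snd b = m) (initial_tableau c)"
  unfolding filled_def
proof (intro ballI allI)
  fix m r assume m: "m \<in> {1..length c}"
  show "initial_tableau c (r, m) =
    (case entry c m r of None \<Rightarrow> 0 | Some b \<Rightarrow> if snd b = m then label c b else 0)"
  proof (cases "(r, m) \<in> boxes c")
    case True
    then have "entry c m r = Some (r, m)" by (auto simp: boxes_def intro: entry_own)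
    with True show ?thesis by (simp add: initial_tableau_def)
  next
    case False
    then have "snd b \<noteq> m" if "entry c m r = Some b" for b
      using that m entry_own_column[of c m r "fst b"] entry_in_boxes[OF that]
      by (metis atLeastAtMost_iff prod.collapse)
    with False show ?thesis by (auto simp: initial_tableau_def split: option.splits)
  qed
qed

text \<open>Induction over prefixes of the order of treatment. As the list is sorted, the prefix
  contains every predecessor of the next box, as \<open>filled_spread\<close> requires.\<close>

lemma filled_fold_spread:
  assumes pos: "\<forall>x\<in>set c. 0 < x" and "boxes_in_order c = xs @ ys"
  shows "filled c (\<lambda>m b. snd b = m \<or> b \<in> set xs)
    (fold (\<lambda>(p, j). spread c (label c (p, j)) p j) xs (initial_tableau c))"
  using assms(2)
proof (induction xs arbitrary: ys rule: rev_induct)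
  case Nil
  then show ?case using filled_initial_tableau by simp
next
  case (snoc b xs)
  obtain p j where b: "b = (p, j)" by fastforce
  have "sorted_wrt prec (xs @ b # ys)" "set (xs @ b # ys) = boxes c"
    using sorted_wrt_prec_boxes_in_order[of c] set_boxes_in_order[of c] unfolding snoc.prems by auto
  then have less: "\<forall>x\<in>set xs. prec x b" "\<forall>y\<in>set ys. prec b y"
    and boxes: "boxes c = insert b (set xs \<union> set ys)"
    by (auto simp: sorted_wrt_append)
  have P: "b' \<in> boxes c \<Longrightarrow> prec b' b \<Longrightarrow> b' \<in> set xs" "b \<notin> set xs" "b \<in> boxes c" for b'
    using less unfolding boxes by (auto dest: prec_asym simp: prec_irrefl)
  let ?T = "fold (\<lambda>(p, j). spread c (label c (p, j)) p j) xs (initial_tableau c)"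
  have j: "1 \<le> j" "j \<le> length c" and e: "entry c j p = Some b"
    using P(3) b by (auto simp: boxes_def intro: entry_own)
  have "filled c (\<lambda>m b'. snd b' = m \<or> b' \<in> set xs) ?T"
    using snoc by simp
  \<comment> \<open>No label occurs left of its own column, so for \<open>b\<close> the condition
    \<open>m \<le> j\<close> adds only its own column \<open>j\<close>.\<close>
  then have "filled c (\<lambda>m b'. snd b' = m \<or> b' \<in> set xs \<or> b' = b \<and> m \<le> j) ?T"
  proof (rule filled_cong)
    fix m r b' assume "entry c m r = Some b'"
    then have "snd b' \<le> m" using entry_column_le[of c m r "fst b'" "snd b'"] by simp
    then show "(snd b' = m \<or> b' \<in> set xs) = (snd b' = m \<or> b' \<in> set xs \<or> b' = b \<and> m \<le> j)"
      using b by auto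
  qed
  from filled_spread[OF pos this e j P(1,2)] show ?case
    using b by simp
qed

text \<open>Once all boxes are treated, the visibility condition holds for every entry.\<close>

lemma tableau_infinity_eq:
  assumes "\<forall>x\<in>set c. 0 < x" "1 \<le> m" "m \<le> length c"
  shows "tableau_infinity c (r, m) = (case entry c m r of None \<Rightarrow> 0 | Some b \<Rightarrow> label c b)"
proof -
  have "filled c (\<lambda>m b. snd b = m \<or> b \<in> boxes c) (tableau_infinity c)"
    using filled_fold_spread[OF assms(1), of "boxes_in_order c" "[]"]
    by (simp add: tableau_infinity_def set_boxes_in_order)
  then show ?thesis
    using assms entry_in_boxes[of c m r] by (auto simp: filled_def split: option.splits)
qed

section \<open>Lines labelled 1 and survival to the last column\<close>

lemma line_One_iff:
  assumes pos: "\<forall>x\<in>set c. 0 < x"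
  shows "(\<exists>b'. (b, b', One) \<in> lines c) \<longleftrightarrow>
    (\<exists>m\<in>{1..<length c}. (\<exists>p. entry c m p = Some b) \<and> (\<forall>p. entry c (Suc m) p \<noteq> Some b))"
    (is "?L \<longleftrightarrow> ?R")
proof
  \<comment> \<open>\<open>box_of\<close> inverts \<open>label\<close>, so the left end point of a
    line is the entry itself.\<close>
  have e: "\<exists>b. entry c (m - 1) i = Some b \<and> box_of c (tableau_infinity c (i, m - 1)) = b"
    if "tableau_infinity c (i, m - 1) \<noteq> 0" "m \<in> {2..length c}" for i m
    using that tableau_infinity_eq[OF pos, of "m - 1" i] entry_in_boxes[of c "m - 1" i] box_of_label
    by (auto split: option.splits)
  have R: ?R if "m \<in> {2..length c}" "entry c (m - 1) i = Some b"
      "i < col_height c m \<or> has_left_neighbour c m \<and> i = Suc (col_height c m)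
        \<or> \<not> has_left_neighbour c m \<and> i = col_height c m" for m i
  proof
    have m: "Suc (m - 1) = m" using that(1) by auto
    show "m - 1 \<in> {1..<length c}" using that(1) by auto
    show "(\<exists>p. entry c (m - 1) p = Some b) \<and> (\<forall>p. entry c (Suc (m - 1)) p \<noteq> Some b)"
      using that(2,3) entry_continues_iff[OF that(2)] unfolding m by blast
  qed
  assume ?L
  then obtain i m where "(b, (i, m), One) \<in> lines c" by auto
  then show ?R
  proof (cases rule: lines.cases)
    case above
    then show ?thesis using e R by metis
  next
    case neighbour_one
    then show ?thesis using e R by (metis Suc_eq_plus1)
  next
    case no_neighbour
    then show ?thesis using e R by metis
  qed
next
  assume ?R
  then obtain m p where m: "m \<in> {1..<length c}" and p: "entry c m p = Some b"
    and "\<forall>p. entry c (Suc m) p \<noteq> Some b" by blast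
  then have *: "p < col_height c (Suc m)
      \<or> has_left_neighbour c (Suc m) \<and> p = Suc (col_height c (Suc m))
      \<or> \<not> has_left_neighbour c (Suc m) \<and> p = col_height c (Suc m)"
    using entry_continues_iff[OF p] by blast
  have b: "b \<in> boxes c" using entry_in_boxes[OF p] m by simp
  have t: "tableau_infinity c (p, m) = label c b"
    using tableau_infinity_eq[OF pos, of m p] m p by simp
  have "p \<noteq> 0" using p by (metis entry_row_zero option.distinct(1))
  from * show ?L
  proof (elim disjE conjE)
    assume "p < col_height c (Suc m)"
    then have "(box_of c (label c b), (p, Suc m), One) \<in> lines c"
      using m t label_pos[OF b] \<open>p \<noteq> 0\<close> by (intro lines.above[OF _ refl]) auto
    then show ?thesis using box_of_label[OF b] by auto
  next
    assume "has_left_neighbour c (Suc m)" "p = Suc (col_height c (Suc m))"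
    then have "(box_of c (label c b), (col_height c (Suc m), Suc m), One) \<in> lines c"
      using m t label_pos[OF b] by (intro lines.neighbour_one[OF _ refl]) auto
    then show ?thesis using box_of_label[OF b] by auto
  next
    assume "\<not> has_left_neighbour c (Suc m)" "p = col_height c (Suc m)"
    then have "(box_of c (label c b), (col_height c (Suc m), Suc m), One) \<in> lines c"
      using m t label_pos[OF b] by (intro lines.no_neighbour[OF _ refl]) auto
    then show ?thesis using box_of_label[OF b] by auto
  qed
qed

text \<open>A box occurs in its own column and never returns once lost; hence never being lost
  amounts to reaching the last column.\<close>

lemma right_extremal_box_iff:
  assumes pos: "\<forall>x\<in>set c. 0 < x"
  shows "right_extremal_box c b \<longleftrightarrow> (\<exists>p. entry c (length c) p = Some b)"
proof
  assume *: "right_extremal_box c b"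
  obtain r j where b: "b = (r, j)" by fastforce
  have j: "1 \<le> j" "j \<le> length c" and "entry c j r = Some b"
    using * b by (auto simp: right_extremal_box_def boxes_def intro: entry_own)
  have "\<exists>p. entry c m p = Some b" if "j \<le> m" "m \<le> length c" for m
    using that
  proof (induction m rule: dec_induct)
    case base
    show ?case using \<open>entry c j r = Some b\<close> ..
  next
    case (step m)
    then have "\<exists>p. entry c m p = Some b" "m \<in> {1..<length c}" using j by auto
    then show ?case
      using * unfolding right_extremal_box_def line_One_iff[OF pos] by blast
  qed
  then show "\<exists>p. entry c (length c) p = Some b" using j by blast
next
  assume "\<exists>p. entry c (length c) p = Some b"
  then obtain p where p: "entry c (length c) p = Some b" ..
  have "\<exists>p. entry c (Suc m) p = Some b" if m: "m < length c" "entry c m p' = Some b" for m p'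
  proof (rule ccontr)
    assume "\<nexists>p. entry c (Suc m) p = Some b"
    moreover have "snd b \<le> Suc m" using entry_column_le[of c m p' "fst b" "snd b"] m by simp
    ultimately show False using entry_vanished[of c "Suc m" b "length c" p] p Suc_leI[OF m(1)] by blast
  qed
  then show "right_extremal_box c b"
    unfolding right_extremal_box_def line_One_iff[OF pos]
    using entry_in_boxes[OF p] by (meson atLeastLessThan_iff order_refl)
qed

section \<open>Tracing a row leftwards through columns and staircases\<close>

lemma entry_skip:
  assumes "i \<le> m"
    and "\<And>k. i < k \<Longrightarrow> k \<le> m \<Longrightarrow>
      col_height c k < p \<and> \<not> (Suc (col_height c k) = p \<and> has_left_neighbour c k)"
  shows "entry c m p = entry c i p"
  using assms
proof (induction m rule: dec_induct)
  case (step m)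
  have "entry c (Suc m) p = entry c m p" using step.hyps step.prems[of "Suc m"] by auto
  moreover have "entry c m p = entry c i p" by (rule step.IH) (use step.prems in auto)
  ultimately show ?case by (rule trans)
qed simp

lemma entry_left_neighbour_step:
  assumes "0 < k" "has_left_neighbour c k"
  shows "entry c k (Suc (col_height c k)) = entry c (k - 1) (col_height c k)"
  using assms by (cases k) auto

text \<open>Of the columns of maximal height in a range, only the leftmost can lack a left neighbour.\<close>

lemma rightmost_highest_column:
  assumes "i < k" "k \<le> m" "col_height c k = d" "has_left_neighbour c k"
    and le: "\<And>l. i < l \<Longrightarrow> l \<le> m \<Longrightarrow> col_height c l \<le> d"
  obtains k' where "i < k'" "k' \<le> m" "col_height c k' = d" "has_left_neighbour c k'"
    "\<And>l. k' < l \<Longrightarrow> l \<le> m \<Longrightarrow> col_height c l < d"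
proof -
  let ?K = "{k. i < k \<and> k \<le> m \<and> col_height c k = d \<and> has_left_neighbour c k}"
  have fin: "finite ?K" by (rule finite_subset[of _ "{..m}"]) auto
  have "k \<in> ?K" using assms by simp
  then have K: "Max ?K \<in> ?K" using Max_in[OF fin] by blast
  have "col_height c l < d" if l: "Max ?K < l" "l \<le> m" for l
  proof (rule ccontr)
    assume "\<not> col_height c l < d"
    moreover have "i < l" using K l by simp
    ultimately have "col_height c l = d" using le[of l] l by simp
    moreover have "has_left_neighbour c l"
      unfolding has_left_neighbour_def using K l \<open>col_height c l = d\<close>
      by (intro bexI[of _ "Max ?K"]) auto
    ultimately have "l \<in> ?K" using l \<open>i < l\<close> by simp
    then show False using Max_ge[OF fin] l by fastforce
  qed
  with K show ?thesis using that by blast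
qed

text \<open>Read leftwards, column \<open>f j\<close> turns row \<open>j + 1\<close> into row
  \<open>j\<close>, and the columns between \<open>f (j - 1)\<close> and \<open>f j\<close> are too
  short to affect that row. The trace leaves the staircase in row \<open>u\<close>.\<close>

lemma staircase_entry:
  assumes f: "\<And>j. j \<in> {u..d} \<Longrightarrow> f j \<in> {1..length c} \<and> col_height c (f j) = j \<and> has_left_neighbour c (f j)"
    and mono: "strict_mono_on {u..d} f"
    and gap: "\<And>j i. j \<in> {u..<d} \<Longrightarrow> f j < i \<Longrightarrow> i < f (j + 1) \<Longrightarrow> col_height c i < j"
    and "u \<le> j" "j \<le> d"
  shows "entry c (f j) (Suc j) = entry c (f u - 1) u"
  using assms(4,5)
proof (induction j rule: dec_induct)
  case base
  then show ?case using entry_left_neighbour_step[of "f u" c] f[of u] by simp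
next
  case (step j)
  have less: "f j < f (Suc j)" using mono step by (auto simp: strict_mono_on_def)
  have "entry c (f (Suc j)) (Suc (Suc j)) = entry c (f (Suc j) - 1) (Suc j)"
    using entry_left_neighbour_step[of "f (Suc j)" c] f[of "Suc j"] step by simp
  also have "\<dots> = entry c (f j) (Suc j)"
  proof (rule entry_skip)
    fix k assume "f j < k" "k \<le> f (Suc j) - 1"
    then have "col_height c k < j" using gap[of j k] step.hyps step.prems by simp
    then show "col_height c k < Suc j \<and> \<not> (Suc (col_height c k) = Suc j \<and> has_left_neighbour c k)"
      by simp
  qed (use less in simp)
  also have "\<dots> = entry c (f u - 1) u" using step by simp
  finally show ?case .
qed

lemma staircase_columnsE:
  assumes "staircase_columns c u d S"
  obtains f where "1 \<le> u" "u \<le> d" "S = f ` {u..d}" "strict_mono_on {u..d} f"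
    "\<And>j. j \<in> {u..d} \<Longrightarrow> f j \<in> {1..length c} \<and> col_height c (f j) = j \<and> has_left_neighbour c (f j)"
    "\<And>j i. j \<in> {u..<d} \<Longrightarrow> f j < i \<Longrightarrow> i < f (j + 1) \<Longrightarrow> col_height c i < j"
    "Min S = f u" "Max S = f d"
proof -
  from assms obtain f where f: "1 \<le> u" "u \<le> d" "S = f ` {u..d}" "strict_mono_on {u..d} f"
    "\<And>j. j \<in> {u..d} \<Longrightarrow> f j \<in> {1..length c} \<and> col_height c (f j) = j \<and> has_left_neighbour c (f j)"
    "\<And>j i. j \<in> {u..<d} \<Longrightarrow> f j < i \<Longrightarrow> i < f (j + 1) \<Longrightarrow> col_height c i < j"
    unfolding staircase_columns_def by blast
  have mono: "f i \<le> f j" if "u \<le> i" "i \<le> j" "j \<le> d" for i j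
    using f(4) that by (cases "i = j") (auto simp: strict_mono_on_def intro!: less_imp_le)
  have "Min S = f u" "Max S = f d"
    using f(2,3) by (auto intro!: Min_eqI Max_eqI mono)
  with f that show ?thesis by blast
qed

text \<open>Prolongation to the left, used to contradict maximality.\<close>

lemma staircase_columns_extend:
  assumes S: "staircase_columns c (Suc u) d S" and "1 \<le> u"
    and k: "1 \<le> k" "k < Min S" "col_height c k = u" "has_left_neighbour c k"
    and gap: "\<And>l. k < l \<Longrightarrow> l < Min S \<Longrightarrow> col_height c l < u"
  shows "staircase_columns c u d (insert k S)"
proof -
  from S obtain f where "1 \<le> Suc u" and f: "Suc u \<le> d" "S = f ` {Suc u..d}" "strict_mono_on {Suc u..d} f"
    "\<And>j. j \<in> {Suc u..d} \<Longrightarrow> f j \<in> {1..length c} \<and> col_height c (f j) = j \<and> has_left_neighbour c (f j)"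
    "\<And>j i. j \<in> {Suc u..<d} \<Longrightarrow> f j < i \<Longrightarrow> i < f (j + 1) \<Longrightarrow> col_height c i < j"
    and min: "Min S = f (Suc u)" and "Max S = f d"
    by (rule staircase_columnsE) (rule that)
  have "f (Suc u) \<le> f j" if "j \<in> {Suc u..d}" for j
    using f(3) that by (cases "j = Suc u") (auto simp: strict_mono_on_def intro!: less_imp_le)
  then have below: "k < f j" if "j \<in> {Suc u..d}" for j
    using that k(2) min by fastforce
  have ud: "{u..d} = insert u {Suc u..d}" using f(1) by auto
  let ?f = "f(u := k)"
  have "insert k S = ?f ` {u..d}" unfolding ud f(2) by (auto simp: image_iff)
  moreover have "strict_mono_on {u..d} ?f"
    using f(3) below by (auto simp: strict_mono_on_def)
  moreover have "\<forall>j\<in>{u..d}. ?f j \<in> {1..length c} \<and> col_height c (?f j) = j \<and> has_left_neighbour c (?f j)"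
  proof
    fix j assume "j \<in> {u..d}"
    then show "?f j \<in> {1..length c} \<and> col_height c (?f j) = j \<and> has_left_neighbour c (?f j)"
      using f(4)[of j] f(4)[of "Suc u"] f(1) below[of "Suc u"] k by (cases "j = u") auto
  qed
  moreover have "\<forall>j\<in>{u..<d}. \<forall>i. ?f j < i \<and> i < ?f (j + 1) \<longrightarrow> col_height c i < j"
  proof (intro ballI allI impI)
    fix j i assume "j \<in> {u..<d}" "?f j < i \<and> i < ?f (j + 1)"
    then show "col_height c i < j"
      using f(5)[of j i] gap[of i] min by (cases "j = u") auto
  qed
  ultimately show ?thesis
    unfolding staircase_columns_def using \<open>1 \<le> u\<close> f(1) by (intro conjI exI[of _ ?f]) auto
qed

text \<open>Right extremality keeps row \<open>d + 1\<close> unchanged back to the last column of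
  \<open>S\<close>. Left of \<open>f u\<close>, maximality forbids a further shift, so row
  \<open>u\<close> leads to the nearest box, which owns its position.\<close>

lemma right_extremal_staircase_entry:
  assumes pos: "\<forall>x\<in>set c. 0 < x" and S: "right_extremal_staircase c u d S"
  shows "entry c (length c) (Suc d) = Some (staircase_box c u S)"
proof -
  have cs: "staircase_columns c u d S"
    and max: "\<And>u' d' S'. staircase_columns c u' d' S' \<Longrightarrow> S \<subseteq> S' \<Longrightarrow> S' = S"
    and ext: "\<And>i. Max S < i \<Longrightarrow> i \<le> length c \<Longrightarrow> col_height c i < d"
    using S by (auto simp: right_extremal_staircase_def column_staircase_def)
  from cs obtain f where u: "1 \<le> u" "u \<le> d" and S_eq: "S = f ` {u..d}"
    and mono: "strict_mono_on {u..d} f"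
    and f: "\<And>j. j \<in> {u..d} \<Longrightarrow> f j \<in> {1..length c} \<and> col_height c (f j) = j \<and> has_left_neighbour c (f j)"
    and gap: "\<And>j i. j \<in> {u..<d} \<Longrightarrow> f j < i \<Longrightarrow> i < f (j + 1) \<Longrightarrow> col_height c i < j"
    and Min: "Min S = f u" and Max: "Max S = f d"
    by (rule staircase_columnsE) (rule that)
  have fu: "1 \<le> f u" "f u \<le> length c" "col_height c (f u) = u" "has_left_neighbour c (f u)"
    using f[of u] u by auto
  let ?I = "{i. (u, i) \<in> boxes c \<and> i < f u}"
  have fin: "finite ?I" by (rule finite_subset[of _ "{..<f u}"]) auto
  \<comment> \<open>The left neighbour of \<open>f u\<close> has height \<open>u\<close> and
    therefore meets row \<open>u\<close>.\<close>
  have "?I \<noteq> {}"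
    using fu u by (fastforce simp: has_left_neighbour_def boxes_def)
  then have I: "Max ?I \<in> ?I" using Max_in[OF fin] by blast
  let ?i = "Max ?I"
  have low: "col_height c l < u" if "?i < l" "l < f u" for l
  proof (rule ccontr)
    assume "\<not> col_height c l < u"
    then have "l \<in> ?I" using that u fu by (simp add: boxes_def)
    then show False using Max_ge[OF fin] that(1) by fastforce
  qed
  \<comment> \<open>A shift into row \<open>u\<close> would need a column of height
    \<open>u - 1\<close> with a left neighbour; the rightmost of these before \<open>f u\<close>
    could be added to \<open>S\<close>.\<close>
  have no: "\<not> (Suc (col_height c l) = u \<and> has_left_neighbour c l)" if l: "?i < l" "l < f u" for l
  proof
    assume *: "Suc (col_height c l) = u \<and> has_left_neighbour c l"
    then obtain v where v: "u = Suc v" "col_height c l = v" by auto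
    obtain k where k: "?i < k" "k \<le> f u - 1" "col_height c k = v" "has_left_neighbour c k"
      "\<And>l. k < l \<Longrightarrow> l \<le> f u - 1 \<Longrightarrow> col_height c l < v"
    proof (rule rightmost_highest_column[of ?i l "f u - 1" c v])
      show "col_height c l \<le> v" if "?i < l" "l \<le> f u - 1" for l
      proof -
        have "l < f u" using that(2) fu(1) by simp
        then have "col_height c l < u" by (rule low[OF that(1)])
        then show ?thesis using v(1) by simp
      qed
    qed (use * l v in auto)
    have "c ! (k - 1) \<in> set c" using k(1,2) fu(1,2) by (intro nth_mem) linarith
    then have "1 \<le> v" using pos k(3) by (auto simp: col_height_def)
    then have "staircase_columns c v d (insert k S)"
      using cs k v fu Min by (intro staircase_columns_extend) auto
    then have "k \<in> S" using max by blast
    then show False using S_eq f k(3) v by fastforce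
  qed
  have "entry c (length c) (Suc d) = entry c (f d) (Suc d)"
  proof (rule entry_skip)
    show "f d \<le> length c" using f[of d] u by simp
    fix k assume "f d < k" "k \<le> length c"
    then have "col_height c k < d" using ext Max by simp
    then show "col_height c k < Suc d \<and> \<not> (Suc (col_height c k) = Suc d \<and> has_left_neighbour c k)"
      by simp
  qed
  also have "\<dots> = entry c (f u - 1) u"
    by (rule staircase_entry[OF f mono gap u(2) order_refl])
  also have "\<dots> = entry c ?i u"
    using I low no fu by (intro entry_skip) auto
  also have "\<dots> = Some (u, ?i)" using I by (auto simp: boxes_def intro: entry_own)
  finally show ?thesis by (simp add: staircase_box_def Min)
qed

text \<open>For the converse, \<open>{k}\<close> alone satisfies the staircase conditions; it is
  prolonged to the left as far as possible. Prolongation to the right is excluded because only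
  columns of height less than \<open>d\<close> follow \<open>k\<close>.\<close>

lemma right_extremal_staircase_exists_iff:
  assumes pos: "\<forall>x\<in>set c. 0 < x"
  shows "(\<exists>u S. right_extremal_staircase c u d S) \<longleftrightarrow>
    (\<exists>k\<in>{1..length c}. col_height c k = d \<and> has_left_neighbour c k \<and>
      (\<forall>l\<in>{1..length c}. k < l \<longrightarrow> col_height c l < d))"
    (is "?L \<longleftrightarrow> ?R")
proof
  assume ?L
  then obtain u S where cs: "staircase_columns c u d S"
    and "\<forall>l\<in>{1..length c}. Max S < l \<longrightarrow> col_height c l < d"
    unfolding right_extremal_staircase_def column_staircase_def by blast
  moreover from cs have "Max S \<in> {1..length c} \<and> col_height c (Max S) = d \<and> has_left_neighbour c (Max S)"
    by (rule staircase_columnsE) simp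
  ultimately show ?R by blast
next
  assume ?R
  then obtain k where k: "k \<in> {1..length c}" "col_height c k = d" "has_left_neighbour c k"
    and ext: "\<forall>l\<in>{1..length c}. k < l \<longrightarrow> col_height c l < d" by blast
  have "0 < d" using pos k by (auto simp: col_height_def)
  let ?U = "\<lambda>u. \<exists>S. staircase_columns c u d S \<and> Max S = k"
  have "staircase_columns c d d {k}"
    unfolding staircase_columns_def using k \<open>0 < d\<close>
    by (intro conjI exI[of _ "\<lambda>_. k"]) (auto simp: strict_mono_on_def)
  then have "?U d" by (intro exI[of _ "{k}"]) simp
  \<comment> \<open>The least height belongs to a longest staircase ending in column
    \<open>k\<close>.\<close>
  define u where "u = (LEAST u. ?U u)"
  then obtain S where cs: "staircase_columns c u d S" and Max: "Max S = k"
    using LeastI[of ?U, OF \<open>?U d\<close>] by blast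
  have "S' = S" if cs': "staircase_columns c u' d' S'" and sub: "S \<subseteq> S'" for u' d' S'
  proof -
    from cs obtain f where "1 \<le> u" and u: "u \<le> d" and S: "S = f ` {u..d}"
      and "strict_mono_on {u..d} f"
      and f: "\<And>j. j \<in> {u..d} \<Longrightarrow> f j \<in> {1..length c} \<and> col_height c (f j) = j \<and> has_left_neighbour c (f j)"
      and "\<And>j i. j \<in> {u..<d} \<Longrightarrow> f j < i \<Longrightarrow> i < f (j + 1) \<Longrightarrow> col_height c i < j"
      and "Min S = f u" and fd: "Max S = f d"
      by (rule staircase_columnsE) (rule that)
    from cs' obtain f' where "1 \<le> u'" "u' \<le> d'" and S': "S' = f' ` {u'..d'}" and mono: "strict_mono_on {u'..d'} f'"
      and f': "\<And>j. j \<in> {u'..d'} \<Longrightarrow> f' j \<in> {1..length c} \<and> col_height c (f' j) = j \<and> has_left_neighbour c (f' j)"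
      and "\<And>j i. j \<in> {u'..<d'} \<Longrightarrow> f' j < i \<Longrightarrow> i < f' (j + 1) \<Longrightarrow> col_height c i < j"
      and "Min S' = f' u'" and Max': "Max S' = f' d'"
      by (rule staircase_columnsE) (rule that)
    \<comment> \<open>The index of a column is its height, so both parametrisations agree on common
      columns.\<close>
    have eq: "j \<in> {u'..d'} \<and> f' j = f j" if j: "j \<in> {u..d}" for j
    proof -
      have "f j \<in> S'" using j S sub by blast
      then obtain i where "i \<in> {u'..d'}" "f j = f' i" using S' by blast
      then show ?thesis using f[OF j] f'[of i] by auto
    qed
    have d: "d \<in> {u'..d'}" "f' d = k" using eq[of d] u fd Max by auto
    have "d' = d"
    proof (rule ccontr)
      assume "d' \<noteq> d"
      with d have "k < f' d'" and "d' \<in> {u'..d'}" "d < d'"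
        using mono by (auto simp: strict_mono_on_def)
      then show False using ext f'[of d'] by fastforce
    qed
    then have "?U u'" using cs' Max' d by blast
    then have "u \<le> u'" unfolding u_def by (rule Least_le)
    moreover have "u' \<le> u" using eq[of "u"] u by simp
    ultimately have "u' = u" by simp
    then show "S' = S" unfolding S S' \<open>d' = d\<close> using eq by (intro image_cong) auto
  qed
  then have "right_extremal_staircase c (u) d S"
    unfolding right_extremal_staircase_def column_staircase_def using cs ext Max by blast
  then show ?L by blast
qed

text \<open>A shift into row \<open>p\<close> right of column \<open>i\<close> happens at a column
  of height \<open>p - 1\<close> with a left neighbour. The rightmost such column would end a right
  extremal staircase of depth \<open>p - 1\<close>.\<close>

lemma entry_without_staircase:
  assumes pos: "\<forall>x\<in>set c. 0 < x" and "i \<le> length c"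
    and less: "\<And>l. i < l \<Longrightarrow> l \<le> length c \<Longrightarrow> col_height c l < p"
    and none: "\<nexists>u S. right_extremal_staircase c u (p - 1) S"
  shows "entry c (length c) p = entry c i p"
proof (rule entry_skip[OF assms(2)])
  fix k assume k: "i < k" "k \<le> length c"
  have "\<not> (Suc (col_height c k) = p \<and> has_left_neighbour c k)"
  proof
    assume *: "Suc (col_height c k) = p \<and> has_left_neighbour c k"
    obtain k' where "i < k'" "k' \<le> length c" "col_height c k' = p - 1" "has_left_neighbour c k'"
      "\<And>l. k' < l \<Longrightarrow> l \<le> length c \<Longrightarrow> col_height c l < p - 1"
    proof (rule rightmost_highest_column[of i k "length c" c "p - 1"])
      show "col_height c l \<le> p - 1" if "i < l" "l \<le> length c" for l
        using less[OF that] by simp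
    qed (use * k in auto)
    then have "\<exists>u S. right_extremal_staircase c u (p - 1) S"
      unfolding right_extremal_staircase_exists_iff[OF pos] by (intro bexI[of _ k']) auto
    then show False using none by blast
  qed
  then show "col_height c k < p \<and> \<not> (Suc (col_height c k) = p \<and> has_left_neighbour c k)"
    using less k by simp
qed

section \<open>Right extremal columns and the list of all right extremal boxes\<close>

lemma max_height_right_less_iff:
  "max_height_right c i < p \<longleftrightarrow> 0 < p \<and> (\<forall>l. i < l \<longrightarrow> l \<le> length c \<longrightarrow> col_height c l < p)"
  unfolding max_height_right_def by (subst Max_less_iff) auto

lemma col_height_le_max_height_right:
  "i < l \<Longrightarrow> l \<le> length c \<Longrightarrow> col_height c l \<le> max_height_right c i"
  unfolding max_height_right_def by (intro Max_ge) auto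

text \<open>Row \<open>p\<close> is followed back to the rightmost column that reaches it; all later
  columns are shorter than \<open>p\<close>, so this column is right extremal.\<close>

lemma entry_last_column_cases:
  assumes pos: "\<forall>x\<in>set c. 0 < x" and b: "entry c (length c) p = Some b"
    and none: "\<nexists>u S. right_extremal_staircase c u (p - 1) S"
  obtains i where "b = (p, i)" "right_extremal_column c i" "b \<in> lower_part c i"
proof -
  have "p \<noteq> 0" using b by (metis entry_row_zero option.distinct(1))
  \<comment> \<open>The value 0 stands for the case that no column reaches row \<open>p\<close>; it
    is ruled out because column 0 has no entries.\<close>
  let ?I = "insert 0 {i. (p, i) \<in> boxes c}"
  let ?i = "Max ?I"
  have fin: "finite ?I"
    by (rule finite_subset[of _ "{..length c}"]) (auto simp: boxes_def)
  have I: "?i \<in> ?I" using Max_in[OF fin] by blast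
  then have le: "?i \<le> length c" by (auto simp: boxes_def)
  have less: "col_height c l < p" if "?i < l" "l \<le> length c" for l
  proof (rule ccontr)
    assume "\<not> col_height c l < p"
    then have "l \<in> ?I" using that \<open>p \<noteq> 0\<close> by (simp add: boxes_def)
    then show False using Max_ge[OF fin] that(1) by fastforce
  qed
  have "entry c (length c) p = entry c ?i p"
    by (rule entry_without_staircase[OF pos le less none])
  then have "?i \<noteq> 0" using b by (metis entry.simps(1) option.distinct(1))
  then have box: "(p, ?i) \<in> boxes c" using I by simp
  then have i: "1 \<le> ?i" "p \<le> col_height c ?i" by (auto simp: boxes_def)
  then have "b = (p, ?i)"
    using b \<open>entry c (length c) p = entry c ?i p\<close> \<open>p \<noteq> 0\<close> entry_own[of p ?i c] by simp
  moreover have "max_height_right c ?i < p"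
    using less \<open>p \<noteq> 0\<close> by (simp only: max_height_right_less_iff) simp
  ultimately show ?thesis
    using that[of ?i] box i le by (auto simp: right_extremal_column_def lower_part_def)
qed

theorem theorem3p6:
  fixes n :: nat and cs D :: "nat list"
  assumes "n > 0" and "composition n cs" and "length cs \<ge> 2"
    and D: "D = butlast cs"
  shows "(\<forall>c u S. c \<le> Max (set D) \<and> right_extremal_staircase D u c S \<longrightarrow>
            right_extremal_box D (staircase_box D u S))
       \<and> {b. right_extremal_box D b} -
           {staircase_box D u S | c u S. c \<le> Max (set D) \<and> right_extremal_staircase D u c S}
         = (\<Union>i\<in>{i. right_extremal_column D i}.
              {b \<in> lower_part D i.
                 \<not> (b = (max_height_right D i + 1, i) \<and>
                    (\<exists>u S. right_extremal_staircase D u (max_height_right D i) S))})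
       \<and> (\<forall>i u S. right_extremal_column D i \<and>
            right_extremal_staircase D u (max_height_right D i) S \<longrightarrow> (\<forall>j\<in>S. i < j))"
    (is "?i \<and> ?RE - ?SB = ?LP \<and> ?iii")
proof (intro conjI)
  have pos: "\<forall>x\<in>set D. 0 < x"
    using assms(2) D by (auto simp: composition_def dest: in_set_butlastD)
  note re_iff = right_extremal_box_iff[OF pos] and st_entry = right_extremal_staircase_entry[OF pos]
  \<comment> \<open>The depth is the height of a column of the diagram, which gives the bound
    demanded in \<open>?SB\<close>.\<close>
  have depth: "d \<le> Max (set D)" if S: "right_extremal_staircase D u d S" for u d S
  proof -
    obtain k where "k \<in> {1..length D}" "col_height D k = d"
      using S right_extremal_staircase_exists_iff[OF pos, of d] by blast
    then show ?thesis by (auto simp: col_height_def)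
  qed
  \<comment> \<open>The last column \<open>k\<close> of the staircase differs from \<open>i\<close>
    in height, and lies right of \<open>i\<close> since only columns lower than \<open>d\<close>
    follow \<open>k\<close>.\<close>
  have above: "d \<le> max_height_right D i"
    if S: "right_extremal_staircase D u d S" and i: "1 \<le> i" "i \<le> length D" "d < col_height D i"
    for u d S i
  proof -
    obtain k where k: "k \<in> {1..length D}" "col_height D k = d"
      "\<forall>l\<in>{1..length D}. k < l \<longrightarrow> col_height D l < d"
      using S right_extremal_staircase_exists_iff[OF pos, of d] by blast
    have "k \<noteq> i" "\<not> k < i" using k i by fastforce+
    then show ?thesis using col_height_le_max_height_right[of i k D] k by auto
  qed
  show ?i using re_iff st_entry by blast
  show "?RE - ?SB = ?LP"
  proof (intro set_eqI iffI)
    fix b assume b: "b \<in> ?RE - ?SB"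
    then obtain p where p: "entry D (length D) p = Some b" using re_iff by blast
    then have "p \<noteq> 0" by (metis entry_row_zero option.distinct(1))
    \<comment> \<open>A staircase of depth \<open>p - 1\<close> would have its box in row
      \<open>p\<close> of the last column, where \<open>b\<close> is.\<close>
    have none: "\<nexists>u S. right_extremal_staircase D u (p - 1) S"
    proof
      assume "\<exists>u S. right_extremal_staircase D u (p - 1) S"
      then obtain u S where S: "right_extremal_staircase D u (p - 1) S" by blast
      then have "b = staircase_box D u S" using st_entry[OF S] p \<open>p \<noteq> 0\<close> by simp
      then show False using b S depth[OF S] by blast
    qed
    obtain i where "b = (p, i)" "right_extremal_column D i" "b \<in> lower_part D i"
      using entry_last_column_cases[OF pos p none] by blast
    then show "b \<in> ?LP" using none by force
  next
    fix b assume "b \<in> ?LP"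
    then obtain p i where i: "right_extremal_column D i" and b: "b = (p, i)" "b \<in> lower_part D i"
      and omit: "\<not> (p = max_height_right D i + 1 \<and>
        (\<exists>u S. right_extremal_staircase D u (max_height_right D i) S))"
      by (auto simp: lower_part_def)
    have p: "1 \<le> i" "i \<le> length D" "p \<le> col_height D i" "max_height_right D i < p"
      using b by (auto simp: lower_part_def boxes_def)
    \<comment> \<open>By \<open>above\<close>, the depth \<open>p - 1\<close> is at most the maximal
      height to the right, hence equal to it; this is exactly the omitted case.\<close>
    have none: "\<nexists>u S. right_extremal_staircase D u (p - 1) S"
    proof
      assume *: "\<exists>u S. right_extremal_staircase D u (p - 1) S"
      then have "p - 1 \<le> max_height_right D i" using above p by fastforce
      then have "p = max_height_right D i + 1" using p by simp
      then show False using * omit by simp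
    qed
    have "entry D (length D) p = entry D i p"
      using none p max_height_right_less_iff[of D i p]
      by (intro entry_without_staircase[OF pos]) auto
    then have e: "entry D (length D) p = Some b"
      using p b by (simp add: entry_own)
    \<comment> \<open>The box of a staircase of depth \<open>d\<close> sits in row
      \<open>d + 1\<close> of the last column, and a box occupies only one row there.\<close>
    have "b \<notin> ?SB"
    proof
      assume "b \<in> ?SB"
      then obtain d u S where S: "right_extremal_staircase D u d S" "b = staircase_box D u S"
        by blast
      then have "p = Suc d" using entry_inj[OF e] st_entry by blast
      then show False using none S by auto
    qed
    then show "b \<in> ?RE - ?SB" using e re_iff by blast
  qed
  show ?iii
  proof (intro allI impI ballI)
    fix i u S j
    let ?d = "max_height_right D i"
    assume A: "right_extremal_column D i \<and> right_extremal_staircase D u ?d S" and "j \<in> S"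
    then have i: "1 \<le> i" "i \<le> length D" "?d < col_height D i"
      by (auto simp: right_extremal_column_def)
    have cs: "staircase_columns D u ?d S"
      and ext: "\<forall>l\<in>{1..length D}. Max S < l \<longrightarrow> col_height D l < ?d"
      using A by (auto simp: right_extremal_staircase_def column_staircase_def)
    from cs obtain f where "1 \<le> u" and f: "u \<le> ?d" "S = f ` {u..?d}"
      and "strict_mono_on {u..?d} f" and f_col:
      "\<And>j. j \<in> {u..?d} \<Longrightarrow> f j \<in> {1..length D} \<and> col_height D (f j) = j \<and> has_left_neighbour D (f j)"
      and gap: "\<And>j i. j \<in> {u..<?d} \<Longrightarrow> f j < i \<Longrightarrow> i < f (j + 1) \<Longrightarrow> col_height D i < j"
      and "Min S = f u" and Max: "Max S = f ?d"
      by (rule staircase_columnsE) (rule that)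
    have ne: "f m \<noteq> i" if "m \<in> {u..?d}" for m using f_col[OF that] that i by auto
    obtain m where m: "m \<in> {u..?d}" "j = f m" using f(2) \<open>j \<in> S\<close> by blast
    have "m \<le> ?d" "u \<le> m" using m by auto
    \<comment> \<open>Descent from the last column of \<open>S\<close>: being taller than
      \<open>?d\<close>, column \<open>i\<close> is not in \<open>S\<close>, does not lie right of
      its last column and fits into no gap.\<close>
    then have "i < f m"
    proof (induction m rule: inc_induct)
      case base
      have "\<not> Max S < i" using ext i by fastforce
      then show ?case using ne[of ?d] f(1) Max by simp
    next
      case (step m)
      then have "\<not> f m < i" using gap[of m i] i by fastforce
      then show ?case using ne[of m] step by simp
    qed
    then show "i < j" using m by simp
  qed
qed

end
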